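(* Let $k\geq 4$ be an integer and let $\mathbf{x}=\mathbf{x}_k$ be the binary sequence defined in the context. Let $\mathcal{C}(n)$ denote the number of distinct factors of $\mathbf{x}$ of length $n$. Then there exists $N_0$ such that for all $N\geq N_0$, $$\Delta\mathcal{C}(N):=\mathcal{C}(N+1)-\mathcal{C}(N)\in\{4k-2,\,4k\}.$$
   Context: Fix an integer $k\geq 4$. Let $\mathcal{A}=\{0,1,\ldots,k-1,0',1',\ldots,(k-1)'\}$ (an alphabet of $2k$ letters). Let $\xi=\xi_k:\mathcal{A}^*\to\mathcal{A}^*$ be the morphism given by $\xi(0)=01$, $\xi(j)=j+1$ for $1\leq j\leq k-2$, $\xi(k-1)=0'$, and $\xi(0')=0'1'$, $\xi(j')=(j+1)'$ for $1\leq j\leq k-2$, $\xi((k-1)')=0$. Let $\mathbf{u}=\xi^\omega(0)$ be the infinite fixed point of $\xi$ starting with $0$. Let $\pi:\mathcal{A}^*\to\{0,1\}^*$ be the letter-to-letter morphism with $\pi(0)=0$, $\pi(j')=0$ for $1\leq j\leq k-1$, $\pi(0')=1$, $\pi(j)=1$ for $1\leq j\leq k-1$. Put $\mathbf{x}=\mathbf{x}_k=\pi(\mathbf{u})$. *)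

theory Defs
  imports Main "HOL-Library.Sublist"
begin

(* The letters j and j'. The alphabet with 2k letters is the set letters k below; the values of
   the maps xi k and coding on letters outside letters k are irrelevant junk. *)
datatype letter = Plain nat | Primed nat

definition letters :: "nat \<Rightarrow> letter set" where
  "letters k = Plain ` {..<k} \<union> Primed ` {..<k}"

(* The monoid morphism on finite words with the given images of letters. *)
definition morphism :: "('a \<Rightarrow> 'b list) \<Rightarrow> 'a list \<Rightarrow> 'b list" where
  "morphism f w = concat (map f w)"

fun xi :: "nat \<Rightarrow> letter \<Rightarrow> letter list" where
  "xi k (Plain j) =
     (if j = 0 then [Plain 0, Plain 1]
      else if j \<le> k - 2 then [Plain (j + 1)]
      else [Primed 0])"
| "xi k (Primed j) =
     (if j = 0 then [Primed 0, Primed 1]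
      else if j \<le> k - 2 then [Primed (j + 1)]
      else [Plain 0])"

(* The infinite word having every iterate f^m(a) as a prefix. Reading off position n in the n-th
   iterate is legitimate when f(a) begins with a and all iterates satisfy |f^n(a)| > n; see
   u_word_prefix and u_word_fixed for the case at hand. *)
definition omega_iterate :: "('a \<Rightarrow> 'a list) \<Rightarrow> 'a \<Rightarrow> nat \<Rightarrow> 'a" where
  "omega_iterate f a n = ((morphism f ^^ n) [a]) ! n"

definition u_word :: "nat \<Rightarrow> nat \<Rightarrow> letter" where
  "u_word k = omega_iterate (xi k) (Plain 0)"

fun coding :: "letter \<Rightarrow> nat" where
  "coding (Plain j) = (if j = 0 then 0 else 1)"
| "coding (Primed j) = (if j = 0 then 1 else 0)"

definition x_word :: "nat \<Rightarrow> nat \<Rightarrow> nat" where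
  "x_word k n = coding (u_word k n)"

definition factors :: "(nat \<Rightarrow> 'a) \<Rightarrow> nat \<Rightarrow> 'a list set" where
  "factors x n = {map x [i..<i + n] | i. True}"

definition factor_complexity :: "(nat \<Rightarrow> 'a) \<Rightarrow> nat \<Rightarrow> nat" where
  "factor_complexity x n = card (factors x n)"


lemma morphism_append: "morphism f (v @ w) = morphism f v @ morphism f w"
  by (simp add: morphism_def)

lemma morphism_pow_append:
  fixes f :: "'a \<Rightarrow> 'a list"
  shows "(morphism f ^^ m) (v @ w) = (morphism f ^^ m) v @ (morphism f ^^ m) w"
  by (induction m) (simp_all add: morphism_append)

lemma length_morphism_xi: "length w \<le> length (morphism (xi k) w)"
proof (induction w)
  case (Cons a w)
  have "1 \<le> length (xi k a)" by (cases a) auto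
  with Cons show ?case by (simp add: morphism_def)
qed (simp add: morphism_def)

lemma length_morphism_xi_pow: "length w \<le> length ((morphism (xi k) ^^ m) w)"
  by (induction m) (auto intro: order_trans length_morphism_xi)

lemma xi_iterate_Suc:
  "(morphism (xi k) ^^ Suc m) [Plain 0] =
     (morphism (xi k) ^^ m) [Plain 0] @ (morphism (xi k) ^^ m) [Plain 1]"
proof -
  have "morphism (xi k) [Plain 0] = [Plain 0] @ [Plain 1]" by (simp add: morphism_def)
  then show ?thesis by (simp only: funpow_Suc_right o_apply morphism_pow_append)
qed

lemma length_xi_iterate: "m < length ((morphism (xi k) ^^ m) [Plain 0])"
proof (induction m)
  case (Suc m)
  have "1 \<le> length ((morphism (xi k) ^^ m) [Plain 1])"
    using length_morphism_xi_pow[of "[Plain 1]"] by simp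
  with Suc show ?case by (simp only: xi_iterate_Suc length_append)
qed simp

lemma xi_iterate_prefix:
  "m \<le> n \<Longrightarrow> prefix ((morphism (xi k) ^^ m) [Plain 0]) ((morphism (xi k) ^^ n) [Plain 0])"
proof (induction rule: dec_induct)
  case (step n)
  show ?case unfolding xi_iterate_Suc by (rule prefix_prefix[OF step.IH])
qed simp

lemma u_word_prefix:
  assumes "i < length ((morphism (xi k) ^^ m) [Plain 0])"
  shows "((morphism (xi k) ^^ m) [Plain 0]) ! i = u_word k i"
proof (cases "m \<le> i")
  case True
  from xi_iterate_prefix[OF this, of k] assms show ?thesis
    by (auto simp: u_word_def omega_iterate_def prefix_def nth_append)
next
  case False
  then have "i \<le> m" by simp
  from xi_iterate_prefix[OF this, of k] length_xi_iterate[of i k] show ?thesis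
    by (auto simp: u_word_def omega_iterate_def prefix_def nth_append)
qed

lemma u_word_fixed:
  assumes "i < length (morphism (xi k) (map (u_word k) [0..<n]))"
  shows "morphism (xi k) (map (u_word k) [0..<n]) ! i = u_word k i"
proof -
  let ?p = "(morphism (xi k) ^^ n) [Plain 0]"
  have len: "n < length ?p" by (rule length_xi_iterate)
  have "map (u_word k) [0..<n] = take n ?p"
    using len by (intro nth_equalityI) (auto simp: u_word_prefix)
  then have "?p = map (u_word k) [0..<n] @ drop n ?p" by simp
  then have "(morphism (xi k) ^^ Suc n) [Plain 0] =
      morphism (xi k) (map (u_word k) [0..<n]) @ morphism (xi k) (drop n ?p)"
    by (metis funpow.simps(2) o_apply morphism_append)
  with assms u_word_prefix[of i "Suc n" k] show ?thesis
    by (simp add: nth_append del: funpow.simps)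
qed

lemma u_word_letters:
  assumes "k \<ge> 2"
  shows "u_word k n \<in> letters k"
proof -
  have step: "set (xi k a) \<subseteq> letters k" if "a \<in> letters k" for a
    using that assms by (cases a) (auto simp: letters_def image_iff)
  have "set ((morphism (xi k) ^^ m) [Plain 0]) \<subseteq> letters k" for m
  proof (induction m)
    case 0
    show ?case using assms by (auto simp: letters_def)
  next
    case (Suc m)
    then show ?case using step by (fastforce simp: morphism_def)
  qed
  then show ?thesis
    unfolding u_word_def omega_iterate_def using length_xi_iterate nth_mem by blast
qed

end

theory Submission
  imports Defs
begin

text \<open>
  The last letters of the words \<open>\<xi>(a)\<close> form a cycle \<open>\<sigma>\<close> of length \<open>2k\<close> on the alphabet, and every letter
  precedes arbitrarily long prefixes of \<open>u\<close> and of its primed copy \<open>u'\<close>. Only \<open>0\<close> and \<open>0'\<close>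
  have more than one possible predecessor. The code of the past of a letter ends with
  \<open>0 1\<^sup>h\<close> or \<open>1 0\<^sup>h\<close>, \<open>1 \<le> h \<le> k\<close>, so the \<open>2k\<close> pasts branch at \<open>2k - 1\<close> words
  \<open>d\<^sup>i\<close> with \<open>i < k\<close>, which yields \<open>4k - 2\<close> left special factors of every large length:
  the prefixes of \<open>d\<^sup>i x\<close> and of \<open>d\<^sup>i\<close> followed by the complement of \<open>x\<close>.

  Let \<open>U\<^sub>m\<close> be the length of \<open>P\<^sub>m = \<xi>\<^sup>m(0)\<close>, so \<open>U\<^sub>m\<^sub>+\<^sub>1 = U\<^sub>m + U\<^sub>m\<^sub>-\<^sub>k\<^sub>+\<^sub>1\<close>.
  Desubstituting an inner occurrence of \<open>0\<close> until it is no longer followed by \<open>1\<close> shows that it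
  starts an occurrence of \<open>P\<^sub>m P\<^sub>m\<close> or \<open>P\<^sub>m P'\<^sub>m\<^sub>+\<^sub>2\<close>, where its predecessor
  is \<open>\<sigma>\<^sup>m((k-1)')\<close>; the code therefore leaves \<open>x\<close> exactly at \<open>U\<^sub>m\<close> or \<open>U\<^sub>m\<^sub>+\<^sub>1\<close>.
  Two occurrences with different predecessors can leave \<open>x\<close> at the same place only if their
  levels are \<open>m\<close> and \<open>m + 1\<close>, and then they separate after another \<open>U\<^sub>m\<^sub>-\<^sub>2\<^sub>k\<^sub>+\<^sub>2\<close> letters. The resulting
  ranges of lengths are disjoint for large \<open>m\<close>, so there is at most one exceptional left special
  factor and its complement.
\<close>

section \<open>Signed letters, and the symmetry exchanging primed and unprimed letters\<close>

definition lt :: "bool \<Rightarrow> nat \<Rightarrow> letter" where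
  "lt s j = (if s then Primed j else Plain j)"

lemma lt_eq_iff [simp]: "lt s j = lt s' j' \<longleftrightarrow> s = s' \<and> j = j'"
  by (simp add: lt_def)

lemma lt_cases: obtains s j where "a = lt s j"
  by (cases a) (metis lt_def)+

lemma coding_lt [simp]: "coding (lt s j) = of_bool (s \<longleftrightarrow> j = 0)"
  by (simp add: lt_def)

lemma xi_lt:
  "xi k (lt s j) = (if j = 0 then [lt s 0, lt s 1] else if j \<le> k - 2 then [lt s (j + 1)]
     else [lt (\<not> s) 0])"
  by (simp add: lt_def)

definition bar :: "letter \<Rightarrow> letter" where
  "bar a = (case a of Plain j \<Rightarrow> Primed j | Primed j \<Rightarrow> Plain j)"

lemma bar_lt [simp]: "bar (lt s j) = lt (\<not> s) j"
  by (simp add: bar_def lt_def)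

lemma coding_bar: "coding (bar a) = 1 - coding a"
  by (cases a rule: lt_cases) auto

lemma xi_bar: "xi k (bar a) = map bar (xi k a)"
  by (cases a rule: lt_cases) (simp add: xi_lt)

lemma morphism_xi_bar: "morphism (xi k) (map bar w) = map bar (morphism (xi k) w)"
  by (induction w) (simp_all add: morphism_def xi_bar)

lemma morphism_xi_pow_bar:
  "(morphism (xi k) ^^ m) (map bar w) = map bar ((morphism (xi k) ^^ m) w)"
  by (induction m) (simp_all add: morphism_xi_bar)

lemma coding_le_1: "coding a \<le> 1"
  by (cases a rule: lt_cases) auto

locale xi_word =
  fixes k :: nat
  assumes k4: "4 \<le> k"
begin

abbreviation u :: "nat \<Rightarrow> letter" where "u \<equiv> u_word k"
abbreviation x :: "nat \<Rightarrow> nat" where "x \<equiv> x_word k"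
abbreviation mor :: "letter list \<Rightarrow> letter list" where "mor \<equiv> morphism (xi k)"

definition nxt :: "letter \<Rightarrow> letter" where "nxt a = last (xi k a)"

lemma nxt_lt: "j < k \<Longrightarrow> nxt (lt s j) = (if j < k - 1 then lt s (j + 1) else lt (\<not> s) 0)"
  using k4 by (auto simp: nxt_def xi_lt)

lemma xi_nonempty [simp]: "xi k a \<noteq> []"
  by (cases a rule: lt_cases) (simp add: xi_lt)

lemma x_eq: "x n = coding (u n)"
  by (simp add: x_word_def)

lemma u_cases:
  obtains s j where "u q = lt s j" "j < k"
proof -
  have "u q \<in> letters k" using u_word_letters k4 by simp
  then show ?thesis using that[of False] that[of True] by (auto simp: letters_def lt_def)
qed

lemma u_index: "u q = lt s j \<Longrightarrow> j < k"
  by (metis u_cases lt_eq_iff)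

subsection \<open>Desubstitution\<close>

text \<open>As \<open>u\<close> is fixed by \<open>xi k\<close>, the image of the letter at
  \<open>r\<close> fills the positions from \<open>pos r\<close> to
  \<open>pos (Suc r) - 1\<close>.\<close>

definition pos :: "nat \<Rightarrow> nat" where
  "pos r = length (mor (map u [0..<r]))"

lemma pos_0 [simp]: "pos 0 = 0"
  by (simp add: pos_def morphism_def)

lemma pos_Suc: "pos (Suc r) = pos r + length (xi k (u r))"
  by (simp add: pos_def morphism_append) (simp add: morphism_def)

lemma u_pos_add: "t < length (xi k (u r)) \<Longrightarrow> u (pos r + t) = xi k (u r) ! t"
  using u_word_fixed[of "pos r + t" k "Suc r"]
  by (simp add: pos_def morphism_append nth_append) (simp add: morphism_def)

lemma u_pos: "u (pos r) = hd (xi k (u r))"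
  using u_pos_add[of 0 r] by (simp add: hd_conv_nth)

lemma pos_Suc_gt: "pos r < pos (Suc r)"
  by (simp add: pos_Suc)

lemma u_before_pos: "u (pos (Suc r) - 1) = nxt (u r)"
proof -
  have "pos (Suc r) - 1 = pos r + (length (xi k (u r)) - 1)"
    using xi_nonempty[of "u r"] by (simp add: pos_Suc Suc_leI)
  then show ?thesis
    using u_pos_add[of "length (xi k (u r)) - 1" r] by (simp add: nxt_def last_conv_nth)
qed

lemma u_0: "u 0 = lt False 0"
proof -
  have p: "(mor ^^ 1) [Plain 0] = [Plain 0, Plain 1]" by (simp add: morphism_def)
  have "(mor ^^ 1) [Plain 0] ! 0 = u 0" by (rule u_word_prefix) (simp only: p, simp)
  then show ?thesis unfolding p lt_def by simp
qed

text \<open>The surplus comes from the two-letter image of the zero at position 0; it makes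
  desubstitution a descent on positions.\<close>

lemma pos_gt: "0 < r \<Longrightarrow> r < pos r"
proof (induction r)
  case (Suc r)
  show ?case
  proof (cases r)
    case 0
    then show ?thesis by (simp add: pos_Suc u_0 xi_lt)
  next
    case (Suc r')
    then show ?thesis using Suc.IH pos_Suc_gt[of r] by simp
  qed
qed simp

lemma preimage_position: "\<exists>r t. q = pos r + t \<and> t < length (xi k (u r))"
proof (induction q)
  case 0
  show ?case by (rule exI[of _ 0]) simp
next
  case (Suc q)
  then obtain r t where q: "q = pos r + t" "t < length (xi k (u r))" by blast
  show ?case
  proof (cases "Suc t < length (xi k (u r))")
    case True
    with q show ?thesis by (metis add_Suc_right)
  next
    case False
    with q have "Suc q = pos (Suc r) + 0" by (simp add: pos_Suc)
    then show ?thesis by (metis xi_nonempty length_greater_0_conv)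
  qed
qed

lemma preimage_cases:
  obtains (first) r where "q = pos r"
  | (second) r s where "q = Suc (pos r)" "u r = lt s 0" "u q = lt s 1" "u (pos r) = lt s 0"
proof -
  obtain r t where q: "q = pos r + t" "t < length (xi k (u r))"
    using preimage_position by blast
  obtain s j where a: "u r = lt s j" using u_cases by metis
  show ?thesis
  proof (cases "t = 0")
    case True
    then show ?thesis using q first by simp
  next
    case False
    then have "t = 1" "j = 0" using q(2) a by (auto simp: xi_lt split: if_splits)
    then show ?thesis using second[of r s] q a u_pos[of r] u_pos_add[of 1 r]
      by (simp add: xi_lt)
  qed
qed

lemma predecessor:
  assumes "u q = lt s (Suc j)"
  shows "0 < q \<and> u (q - 1) = lt s j"
  using assms
proof (induction j arbitrary: q)
  case 0
  show ?case
  proof (cases q rule: preimage_cases)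
    case (first r)
    obtain s' j' where a: "u r = lt s' j'" using u_cases by metis
    then show ?thesis using 0 first u_pos[of r] by (auto simp: xi_lt split: if_splits)
  next
    case (second r s')
    then show ?thesis using 0 by simp
  qed
next
  case (Suc j)
  have "j < k - 2" using u_index[OF Suc.prems] by simp
  show ?case
  proof (cases q rule: preimage_cases)
    case (first r)
    obtain s' j' where a: "u r = lt s' j'" using u_cases by metis
    then have "u r = lt s (Suc j)" using Suc.prems first u_pos[of r]
      by (auto simp: xi_lt split: if_splits)
    from Suc.IH[OF this] have r: "0 < r" "u (r - 1) = lt s j" by auto
    show ?thesis using u_before_pos[of "r - 1"] pos_Suc_gt[of "r - 1"] r first \<open>j < k - 2\<close>
      by (auto simp: nxt_lt)
  next
    case (second r s')
    then show ?thesis using Suc.prems by simp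
  qed
qed

lemma successor:
  assumes "u q = lt s j"
  shows "u (Suc q) = lt s (Suc j) \<or> (\<exists>s'. u (Suc q) = lt s' 0)"
proof -
  obtain s' j' where a: "u (Suc q) = lt s' j'" using u_cases by metis
  show ?thesis
  proof (cases j')
    case (Suc i)
    then show ?thesis using predecessor[of "Suc q" s' i] a assms by simp
  qed (use a in auto)
qed

lemma preimage_zero:
  assumes "u q = lt s 0"
  obtains (zero) r where "q = pos r" "u r = lt s 0" "u (Suc q) = lt s 1" "Suc (Suc q) = pos (Suc r)"
  | (top) r where "q = pos (Suc r)" "u r = lt (\<not> s) (k - 2)" "u (Suc r) = lt (\<not> s) (k - 1)"
      "Suc q = pos (Suc (Suc r))"
proof (cases q rule: preimage_cases)
  case (first r)
  obtain s' j' where a: "u r = lt s' j'" "j' < k" using u_cases by metis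
  then have "j' = 0 \<and> s' = s \<or> j' = k - 1 \<and> s' = (\<not> s)"
    using assms u_pos[of r] first by (auto simp: xi_lt split: if_splits)
  then show ?thesis
  proof
    assume "j' = 0 \<and> s' = s"
    then show ?thesis using zero[of r] first a u_pos_add[of 1 r] by (simp add: xi_lt pos_Suc)
  next
    assume j: "j' = k - 1 \<and> s' = (\<not> s)"
    then have "u r = lt (\<not> s) (Suc (k - 2))" using a k4 by (simp add: Suc_diff_le numeral_2_eq_2)
    from predecessor[OF this] show ?thesis using top[of "r - 1"] first a j k4
      by (simp add: pos_Suc xi_lt)
  qed
next
  case (second r s')
  then show ?thesis using assms by simp
qed

text \<open>Such a zero is the image of the top letter \<open>lt (\<not> s) (k - 1)\<close>, whose
  predecessor has index \<open>k - 2\<close> and maps to the top letter.\<close>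

lemma before_short_block:
  assumes "u q = lt s 0" "u (Suc q) \<noteq> lt s 1"
  shows "0 < q" "u (q - 1) = lt (\<not> s) (k - 1)"
proof -
  have "0 < q \<and> u (q - 1) = lt (\<not> s) (k - 1)"
    using assms(1)
  proof (cases rule: preimage_zero)
    case (top r)
    then show ?thesis using u_before_pos[of r] pos_Suc_gt[of r] k4 by (auto simp: nxt_lt)
  qed (use assms in simp)
  then show "0 < q" "u (q - 1) = lt (\<not> s) (k - 1)" by auto
qed

text \<open>Such a block is the image of a zero not followed by index 1; the top letter before that
  zero maps to \<open>lt s 0\<close>.\<close>

lemma before_block_of_two:
  assumes "u q = lt s 0" "0 < q" "u (Suc q) = lt s 1" "u (Suc (Suc q)) \<noteq> lt s 2"
  shows "u (q - 1) = lt s 0"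
  using assms(1)
proof (cases rule: preimage_zero)
  case (zero r)
  have "u (Suc r) \<noteq> lt s 1"
  proof
    assume "u (Suc r) = lt s 1"
    then have "u (Suc (Suc q)) = lt s 2"
      using u_pos[of "Suc r"] zero k4 by (simp add: xi_lt numeral_2_eq_2)
    with assms show False by simp
  qed
  from before_short_block[OF zero(2) this] have "0 < r" "u (r - 1) = lt (\<not> s) (k - 1)" .
  then show ?thesis using u_before_pos[of "r - 1"] zero(1) k4 by (simp add: nxt_lt)
next
  case (top r)
  obtain s' j' where "u (Suc (Suc r)) = lt s' j'" using u_cases by metis
  then show ?thesis using u_pos[of "Suc (Suc r)"] assms(3) top(4)
    by (auto simp: xi_lt split: if_splits)
qed

subsection \<open>Blocks and their codes\<close>

definition occ_at :: "nat \<Rightarrow> letter list \<Rightarrow> bool" where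
  "occ_at q w \<longleftrightarrow> (\<forall>t<length w. u (q + t) = w ! t)"

lemma occ_at_Nil [simp]: "occ_at q []"
  by (simp add: occ_at_def)

lemma occ_at_Cons: "occ_at q (a # w) \<longleftrightarrow> u q = a \<and> occ_at (Suc q) w"
  by (simp add: occ_at_def All_less_Suc2)

lemma occ_at_append: "occ_at q (v @ w) \<longleftrightarrow> occ_at q v \<and> occ_at (q + length v) w"
  by (induction v arbitrary: q) (simp_all add: occ_at_Cons)

lemma occ_at_morphism: "occ_at q w \<Longrightarrow> occ_at (pos q) (mor w)"
proof (induction w arbitrary: q)
  case (Cons a w)
  then have a: "u q = a" and "occ_at (pos (Suc q)) (mor w)" by (simp_all add: occ_at_Cons)
  moreover have "occ_at (pos q) (xi k a)" using a u_pos_add[of _ q] by (simp add: occ_at_def)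
  moreover have "mor (a # w) = xi k a @ mor w" by (simp add: morphism_def)
  ultimately show ?case by (simp add: occ_at_append pos_Suc)
qed (simp add: morphism_def)

definition blk :: "bool \<Rightarrow> nat \<Rightarrow> letter list" where
  "blk s m = (mor ^^ m) [lt s 0]"

definition U :: "nat \<Rightarrow> nat" where
  "U m = length (blk False m)"

lemma mor_blk: "mor (blk s m) = blk s (Suc m)"
  by (simp add: blk_def)

lemma blk_0: "blk s 0 = [lt s 0]"
  by (simp add: blk_def)

lemma blk_bar: "blk (\<not> s) m = map bar (blk s m)"
  using morphism_xi_pow_bar[where m = m and w = "[lt s 0]" and k = k] by (simp add: blk_def)

lemma length_blk: "length (blk s m) = U m"
  using blk_bar[of False m] by (cases s) (simp_all add: U_def)

lemma iterate_one: "n + 1 < k \<Longrightarrow> (mor ^^ n) [lt s 1] = [lt s (n + 1)]"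
  by (induction n) (auto simp: morphism_def xi_lt)

lemma iterate_one_wrap:
  assumes "k - 1 \<le> m"
  shows "(mor ^^ m) [lt s 1] = blk (\<not> s) (m - (k - 1))"
proof -
  have m: "m = (m - (k - 1)) + Suc (k - 2)" using assms k4 by simp
  have "(mor ^^ (k - 2)) [lt s 1] = [lt s (k - 1)]" using iterate_one[of "k - 2" s] k4
    by (simp add: Suc_diff_le numeral_2_eq_2)
  then have "(mor ^^ Suc (k - 2)) [lt s 1] = [lt (\<not> s) 0]"
    using k4 by (simp add: morphism_def xi_lt)
  then show ?thesis by (subst m) (simp only: funpow_add blk_def o_apply)
qed

lemma blk_Suc: "blk s (Suc m) = blk s m @ (mor ^^ m) [lt s 1]"
proof -
  have "mor [lt s 0] = [lt s 0] @ [lt s 1]" by (simp add: morphism_def xi_lt)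
  then show ?thesis by (simp only: blk_def funpow_Suc_right o_apply morphism_pow_append)
qed

text \<open>Truncated subtraction is intended: for \<open>m < k - 1\<close> the second factor is a
  single letter with the same code as \<open>blk (\<not> s) 0\<close>.\<close>

lemma coded_blk_Suc:
  "map coding (blk s (Suc m)) = map coding (blk s m) @ map coding (blk (\<not> s) (m - (k - 1)))"
proof (cases "k - 1 \<le> m")
  case True
  then show ?thesis by (simp add: blk_Suc iterate_one_wrap del: One_nat_def)
next
  case False
  then show ?thesis using iterate_one[of m s] by (simp add: blk_Suc blk_0 del: One_nat_def)
qed

lemma U_0: "U 0 = 1"
  by (simp add: U_def blk_0)

lemma U_Suc: "U (Suc m) = U m + U (m - (k - 1))"
  using coded_blk_Suc[of False m] by (metis length_append length_map length_blk)

lemma U_pos: "0 < U m"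
  by (induction m) (simp_all add: U_0 U_Suc)

lemma U_strict_mono: "strict_mono U"
  by (simp add: strict_mono_Suc_iff U_Suc U_pos)

lemma U_less: "m < n \<Longrightarrow> U m < U n" and U_le: "m \<le> n \<Longrightarrow> U m \<le> U n"
  using U_strict_mono by (simp_all add: strict_mono_less strict_mono_less_eq)

lemma U_ge: "m < U m"
proof (induction m)
  case (Suc m)
  then show ?case using U_less[of m "Suc m"] by simp
qed (simp add: U_0)

text \<open>The common limit of the codes of the words \<open>blk s m\<close>.\<close>

definition xs :: "bool \<Rightarrow> nat \<Rightarrow> nat" where
  "xs s n = (if s then 1 - x n else x n)"

lemma x_le_1: "x n \<le> 1"
  using coding_le_1[of "u n"] by (simp add: x_eq)

lemma xs_not: "xs (\<not> s) n = 1 - xs s n"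
  using x_le_1[of n] by (simp add: xs_def)

lemma coding_blk:
  assumes "t < U m"
  shows "coding (blk s m ! t) = xs s t"
proof -
  have "blk False m ! t = u t"
    using u_word_prefix[of t m k] assms by (simp add: blk_def U_def lt_def)
  then show ?thesis using assms blk_bar[of False m] length_blk[of False m]
    by (cases s) (simp_all add: xs_def x_eq coding_bar)
qed

lemma xs_0: "xs s 0 = of_bool s"
  using coding_blk[of 0 0 s] by (simp add: U_0 blk_0)

lemma xs_U_add:
  assumes "t < U (m - (k - 1))"
  shows "xs s (U m + t) = xs (\<not> s) t"
proof -
  have "xs s (U m + t) = map coding (blk s (Suc m)) ! (U m + t)"
    using assms coding_blk[of "U m + t" "Suc m" s] by (simp add: U_Suc length_blk)
  also have "\<dots> = xs (\<not> s) t"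
    unfolding coded_blk_Suc using assms by (simp add: nth_append length_blk coding_blk)
  finally show ?thesis .
qed

lemma xs_U: "xs s (U m) = of_bool (\<not> s)"
  using xs_U_add[of 0 m s] U_pos by (simp add: xs_0)

lemma occ_at_blk_x:
  assumes "occ_at q (blk s m)" "t < U m"
  shows "x (q + t) = xs s t"
  using assms by (metis occ_at_def length_blk coding_blk x_eq)

text \<open>If the level-0 continuation is \<open>0 0'\<close>, then \<open>0'\<close> follows a letter other than \<open>k - 1\<close>, which
  forces the longer block \<open>0' 1' 2'\<close>; this is where \<open>m + 2\<close> comes from.\<close>

lemma zero_occurrence:
  assumes "u q = lt s 0" "0 < q"
  shows "\<exists>m. u (q - 1) = (nxt ^^ m) (lt (\<not> s) (k - 1)) \<and>
    (occ_at q (blk s m @ blk s m) \<or> occ_at q (blk s m @ blk (\<not> s) (m + 2)))"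
  using assms
proof (induction q rule: less_induct)
  case (less q)
  show ?case
  proof (cases "u (Suc q) = lt s 1")
    case True
    from less.prems(1) obtain r where r: "q = pos r" "u r = lt s 0"
    proof (cases rule: preimage_zero)
      case (top r)
      obtain s' j' where "u (Suc (Suc r)) = lt s' j'" using u_cases by metis
      then show ?thesis using u_pos[of "Suc (Suc r)"] True top(4)
        by (auto simp: xi_lt split: if_splits)
    qed
    have "0 < r" using less.prems(2) r(1) by (cases r) simp_all
    then have "r < q" using pos_gt r(1) by simp
    from less.IH[OF this r(2) \<open>0 < r\<close>] obtain m where
      m: "u (r - 1) = (nxt ^^ m) (lt (\<not> s) (k - 1))"
        "occ_at r (blk s m @ blk s m) \<or> occ_at r (blk s m @ blk (\<not> s) (m + 2))" by blast
    have "u (q - 1) = nxt (u (r - 1))" using u_before_pos[of "r - 1"] \<open>0 < r\<close> r(1) by simp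
    then have "u (q - 1) = (nxt ^^ Suc m) (lt (\<not> s) (k - 1))" using m(1) by simp
    moreover have "occ_at q (blk s (Suc m) @ blk s (Suc m)) \<or>
        occ_at q (blk s (Suc m) @ blk (\<not> s) (Suc m + 2))"
      using m(2) occ_at_morphism[of r "blk s m @ blk s m"]
        occ_at_morphism[of r "blk s m @ blk (\<not> s) (m + 2)"] r(1)
      by (auto simp: morphism_append mor_blk)
    ultimately show ?thesis by blast
  next
    case False
    from before_short_block[OF less.prems(1) this]
    have prev: "u (q - 1) = lt (\<not> s) (k - 1)" by simp
    obtain s' where s': "u (Suc q) = lt s' 0" using successor[OF less.prems(1)] False by auto
    have "occ_at q (blk s 0 @ blk s 0) \<or> occ_at q (blk s 0 @ blk (\<not> s) 2)"
    proof (cases "s' = s")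
      case True
      then show ?thesis using s' less.prems(1) by (simp add: blk_0 occ_at_Cons)
    next
      case s: False
      have 1: "u (Suc (Suc q)) = lt (\<not> s) 1"
        using before_short_block[of "Suc q" s'] s s' less.prems(1) k4 by auto
      have 2: "u (Suc (Suc (Suc q))) = lt (\<not> s) 2"
        using before_block_of_two[of "Suc q" s'] 1 s s' less.prems(1) by auto
      have "blk (\<not> s) 2 = [lt (\<not> s) 0, lt (\<not> s) 1, lt (\<not> s) 2]"
        using k4 by (simp add: blk_def numeral_2_eq_2 morphism_def xi_lt)
      then show ?thesis using 1 2 s s' less.prems(1) by (simp add: blk_0 occ_at_Cons)
    qed
    then show ?thesis using prev by (intro exI[of _ 0]) (simp add: numeral_2_eq_2)
  qed
qed

text \<open>In both cases the code of the occurrence leaves \<open>xs s\<close> at a position \<open>U m\<close>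
  or \<open>U (m + 1)\<close>, independently of the remainder of \<open>u\<close>.\<close>

lemma coded_zero_occurrence:
  assumes "u q = lt s 0" "0 < q"
  obtains m where "u (q - 1) = (nxt ^^ m) (lt (\<not> s) (k - 1))" "\<And>t. t < U m \<Longrightarrow> x (q + t) = xs s t"
    "(\<forall>t<U m. x (q + U m + t) = xs s t) \<or> (\<forall>t<U (m + 2). x (q + U m + t) = xs (\<not> s) t)"
proof -
  obtain m where "u (q - 1) = (nxt ^^ m) (lt (\<not> s) (k - 1))"
    "occ_at q (blk s m @ blk s m) \<or> occ_at q (blk s m @ blk (\<not> s) (m + 2))"
    using zero_occurrence[OF assms] by blast
  then show ?thesis using that[of m] occ_at_blk_x by (auto simp: occ_at_append length_blk)
qed

subsection \<open>Synchronisation and the past of a letter\<close>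

text \<open>For a letter followed by a zero, the length of the constant run of code ending there. A
  zero gets \<open>k\<close> because the letter before it then has the top index, the opposite sign
  and the same code.\<close>

definition ht :: "letter \<Rightarrow> nat" where
  "ht a = (case a of Plain j \<Rightarrow> if j = 0 then k else j | Primed j \<Rightarrow> if j = 0 then k else j)"

lemma ht_lt [simp]: "ht (lt s j) = (if j = 0 then k else j)"
  by (simp add: ht_def lt_def)

lemma of_bool_eq_Suc_0 [simp]: "of_bool p = Suc 0 \<longleftrightarrow> p" "Suc 0 = of_bool p \<longleftrightarrow> p"
  by auto

lemma predecessors:
  assumes "u q = lt s j" "t \<le> j"
  shows "t \<le> q \<and> u (q - t) = lt s (j - t)"
  using assms(2)
proof (induction t)
  case (Suc t)
  then have t: "t \<le> q" "u (q - t) = lt s (Suc (j - Suc t))" by (simp_all add: Suc_diff_Suc)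
  from predecessor[OF this(2)] t(1) show ?case by simp
qed (use assms in simp)

lemma code_before_zero:
  assumes "u (Suc q) = lt s' 0"
  shows "ht (u q) \<le> q" "\<And>t. t < ht (u q) \<Longrightarrow> x (q - t) = coding (u q)"
    "x (q - ht (u q)) = 1 - coding (u q)"
proof -
  obtain s j where a: "u q = lt s j" using u_cases by metis
  have "ht (u q) \<le> q \<and> (\<forall>t<ht (u q). x (q - t) = coding (u q))
      \<and> x (q - ht (u q)) = 1 - coding (u q)"
  proof (cases "j = 0")
    case False
    then show ?thesis using predecessors[OF a] a by (simp add: x_eq)
  next
    case True
    have q: "0 < q" "u (q - 1) = lt (\<not> s) (k - 1)"
      using before_short_block[of q s] a True assms by auto
    have p: "u (q - t) = lt (\<not> s) (k - t) \<and> t \<le> q" if "0 < t" "t \<le> k" for t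
      using predecessors[OF q(2), of "t - 1"] that q(1) by (simp add: le_diff_conv)
    have "x (q - t) = coding (u q)" if "t < k" for t
      using p[of t] that a True by (cases "t = 0") (simp_all add: x_eq)
    moreover have "x (q - k) = 1 - coding (u q)" "k \<le> q"
      using p[of k] a True k4 by (simp_all add: x_eq)
    ultimately show ?thesis using a True by simp
  qed
  then show "ht (u q) \<le> q" "\<And>t. t < ht (u q) \<Longrightarrow> x (q - t) = coding (u q)"
    "x (q - ht (u q)) = 1 - coding (u q)" by auto
qed

text \<open>The codes \<open>011\<close> and \<open>100\<close> synchronise: they can only start at a zero letter.\<close>

lemma marker:
  assumes "x p \<noteq> x (Suc p)" "x (Suc p) = x (Suc (Suc p))"
  shows "u p = lt (x p = 1) 0"
proof -
  obtain s j where a: "u p = lt s j" using u_cases by metis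
  have "j = 0"
  proof (rule ccontr)
    assume j: "j \<noteq> 0"
    obtain s1 where s1: "u (Suc p) = lt s1 0"
      using successor[OF a] assms(1) a j by (auto simp: x_eq)
    then have "s1 = s" using assms(1) a j by (cases s; cases s1) (simp_all add: x_eq)
    \<comment> \<open>The zero at \<open>Suc p\<close> follows a letter of its own sign, so index 1
      must come next, which changes the code again.\<close>
    then have "u (Suc (Suc p)) \<noteq> lt s 1" using assms(2) s1 by (auto simp: x_eq)
    then show False using before_short_block[of "Suc p" s] s1 \<open>s1 = s\<close> a by simp
  qed
  then show ?thesis using a by (simp add: x_eq)
qed

lemma zero_within: "\<exists>t<k. \<exists>s. u (i + t) = lt s 0"
proof (rule ccontr)
  assume none: "\<not> ?thesis"
  obtain s j where a: "u i = lt s j" using u_cases by metis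
  have "t < k \<Longrightarrow> u (i + t) = lt s (j + t)" for t
  proof (induction t)
    case (Suc t)
    moreover have "u (i + Suc t) \<noteq> lt s' 0" for s' using none Suc.prems by blast
    ultimately show ?case using successor[of "i + t" s "j + t"] by auto
  qed (simp add: a)
  from this[of "k - 1"] have "j + (k - 1) < k" using u_index k4 by simp
  then have "j = 0" using k4 by simp
  then show False using none a k4 by (metis add_0_right gr_zeroI not_numeral_le_zero)
qed

text \<open>After a block 0 comes a longer one, and after a block 0 1 one of length at least three;
  0 1 2 with one sign is a marker. The first zero after \<open>i\<close> is at most at
  \<open>i + k\<close>, and the two shifts add at most 3.\<close>

lemma marker_within: "\<exists>t<k + 5. x (i + t) \<noteq> x (i + t + 1) \<and> x (i + t + 1) = x (i + t + 2)"
proof -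
  have mark: "x p \<noteq> x (Suc p) \<and> x (Suc p) = x (Suc (Suc p))"
    if "u p = lt s 0" "u (Suc p) = lt s 1" "u (Suc (Suc p)) = lt s 2" for p s
    using that by (simp add: x_eq)
  obtain t s where t: "t < k" "u (Suc i + t) = lt s 0" using zero_within by metis
  obtain p s where p: "i < p" "p \<le> i + k + 1" "u p = lt s 0" "u (Suc p) = lt s 1"
  proof (cases "u (Suc (Suc i + t)) = lt s 1")
    case True
    then show ?thesis using that[of "Suc i + t" s] t by simp
  next
    case False
    then obtain s' where s': "u (Suc (Suc i + t)) = lt s' 0" using successor[OF t(2)] by auto
    then have "u (Suc (Suc (Suc i + t))) = lt s' 1"
      using before_short_block[of "Suc (Suc i + t)" s'] t(2) k4 by auto
    then show ?thesis using that[of "Suc (Suc i + t)" s'] s' t(1) by simp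
  qed
  have "\<exists>p' \<le> p + 2. i < p' \<and> x p' \<noteq> x (Suc p') \<and> x (Suc p') = x (Suc (Suc p'))"
  proof (cases "u (Suc (Suc p)) = lt s 2")
    case True
    then show ?thesis using mark[OF p(3,4)] p(1) by (intro exI[of _ p]) simp
  next
    case False
    then obtain s' where s': "u (Suc (Suc p)) = lt s' 0"
      using successor[OF p(4)] by (auto simp: numeral_2_eq_2)
    have 1: "u (Suc (Suc (Suc p))) = lt s' 1"
      using before_short_block[of "Suc (Suc p)" s'] p(4) s' k4 by fastforce
    have "u (Suc (Suc (Suc (Suc p)))) = lt s' 2"
      using before_block_of_two[of "Suc (Suc p)" s'] p(4) s' 1 by auto
    then show ?thesis using mark[OF s' 1] p(1) by (intro exI[of _ "Suc (Suc p)"]) simp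
  qed
  then obtain p' where p': "p' \<le> p + 2" "i < p'" "x p' \<noteq> x (Suc p')" "x (Suc p') = x (Suc (Suc p'))"
    by blast
  have "p' = i + (p' - i)" "p' - i < k + 5" using p' p(2) by auto
  then show ?thesis using p'(3,4) by (intro exI[of _ "p' - i"]) simp
qed

text \<open>For distinct letters followed by zeros, the length of the longest common suffix of the
  codes of their pasts, the letters included.\<close>

definition merge :: "letter \<Rightarrow> letter \<Rightarrow> nat" where
  "merge a b = (if coding a = coding b then min (ht a) (ht b) else 0)"

lemma merge_commute: "merge a b = merge b a"
  by (simp add: merge_def min.commute)

lemma ht_inject:
  assumes "coding (u q) = coding (u q')" "ht (u q) = ht (u q')"
  shows "u q = u q'"
proof -
  obtain s j where a: "u q = lt s j" "j < k" using u_cases by metis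
  obtain s' j' where b: "u q' = lt s' j'" "j' < k" using u_cases by metis
  show ?thesis using assms a b by (cases s; cases s') (auto split: if_splits)
qed

lemma ht_u: "0 < ht (u q)" "ht (u q) \<le> k"
  using u_cases[of q] k4 by (metis ht_lt gr_zeroI le_less_trans less_imp_le_nat not_numeral_le_zero order_refl)+

lemma merge_less:
  assumes "u q \<noteq> u q'"
  shows "merge (u q) (u q') < k"
proof (cases "coding (u q) = coding (u q')")
  case True
  then have "ht (u q) \<noteq> ht (u q')" using ht_inject assms by blast
  then show ?thesis using ht_u[of q] ht_u[of q'] by (auto simp: merge_def min_def)
qed (use k4 in \<open>simp add: merge_def\<close>)

text \<open>Between the left ends, where the codes differ, and a common marker there is a first place
  where the letters agree; a letter with several predecessors is a zero letter, and the
  suffix code of the pasts determines the distance to the left end.\<close>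

lemma left_special_desubstitute:
  assumes "x i \<noteq> x j" "\<And>t. t < N \<Longrightarrow> x (Suc i + t) = x (Suc j + t)" "k + 7 \<le> N"
  obtains s g where "u (i + g + 1) = lt s 0" "u (j + g + 1) = lt s 0" "u (i + g) \<noteq> u (j + g)"
    "g = merge (u (i + g)) (u (j + g))" "\<And>t. t < g \<Longrightarrow> x (Suc i + t) = coding (u (i + g))"
proof -
  obtain t where t: "t < k + 5" "x (Suc i + t) \<noteq> x (Suc i + t + 1)"
    "x (Suc i + t + 1) = x (Suc i + t + 2)" using marker_within by blast
  have eq: "x (Suc i + t) = x (Suc j + t)" "x (Suc i + t + 1) = x (Suc j + t + 1)"
    "x (Suc i + t + 2) = x (Suc j + t + 2)"
    using assms(2)[of t] assms(2)[of "t + 1"] assms(2)[of "t + 2"] assms(3) t(1) by simp_all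
  have "u (Suc i + t) = u (Suc j + t)"
    using marker[of "Suc i + t"] marker[of "Suc j + t"] t(2,3) eq by simp
  then have "u (i + Suc t) = u (j + Suc t)" "u (i + 0) \<noteq> u (j + 0)"
    using assms(1) by (auto simp: x_eq)
  from ex_least_nat_less[of "\<lambda>n. u (i + n) = u (j + n)", OF this]
  obtain g where g: "g < Suc t" "u (i + g) \<noteq> u (j + g)" "u (i + (g + 1)) = u (j + (g + 1))"
    by auto
  obtain s l where sl: "u (i + g + 1) = lt s l" using u_cases by metis
  have "l = 0"
  proof (rule ccontr)
    assume "l \<noteq> 0"
    then obtain l' where "l = Suc l'" by (cases l) auto
    then show False
      using predecessor[of "i + g + 1" s l'] predecessor[of "j + g + 1" s l'] sl g by simp
  qed
  then have z: "u (Suc (i + g)) = lt s 0" "u (Suc (j + g)) = lt s 0" using sl g(3) by simp_all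
  note a = code_before_zero[OF z(1)] and b = code_before_zero[OF z(2)]
  have gN: "g < N" using g(1) t(1) assms(3) by simp
  have backward: "x (i + g - t) = x (j + g - t)" if "t < g" for t
  proof -
    have e: "i + g - t = Suc i + (g - t - 1)" "j + g - t = Suc j + (g - t - 1)" using that by simp_all
    show ?thesis unfolding e using that gN by (intro assms(2)) simp
  qed
  have "g = merge (u (i + g)) (u (j + g))"
  proof (cases "coding (u (i + g)) = coding (u (j + g))")
    case False
    then have "\<not> 0 < g" using backward[of 0] by (auto simp: x_eq)
    then show ?thesis using False by (simp add: merge_def)
  next
    case True
    \<comment> \<open>Reading backwards, the codes agree for exactly \<open>?h\<close> steps, and
      the first disagreement has to be at \<open>i\<close> and \<open>j\<close>.\<close>
    let ?h = "min (ht (u (i + g))) (ht (u (j + g)))"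
    have c: "coding (u n) \<noteq> 1 - coding (u n)" for n
      using coding_le_1[of "u n"] by arith
    have "ht (u (i + g)) \<noteq> ht (u (j + g))" using ht_inject True g(2) by blast
    then have "ht (u (i + g)) < ht (u (j + g)) \<or> ht (u (j + g)) < ht (u (i + g))" by auto
    then have "x (i + g - ?h) \<noteq> x (j + g - ?h)"
      using a(2)[of ?h] a(3) b(2)[of ?h] b(3) True c[of "i + g"] c[of "j + g"] by auto
    then have "g \<le> ?h" using backward[of ?h] by (meson not_less)
    moreover have "\<not> g < ?h" using a(2)[of g] b(2)[of g] True assms(1) by auto
    ultimately have "g = ?h" by (meson le_neq_implies_less)
    then show ?thesis using True by (simp add: merge_def)
  qed
  moreover have "x (Suc i + t) = coding (u (i + g))" if "t < g" for t
  proof -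
    have "g \<le> ht (u (i + g))" using calculation that by (auto simp: merge_def split: if_splits)
    then have "x (i + g - (g - t - 1)) = coding (u (i + g))" using that by (intro a(2)) simp
    moreover have "i + g - (g - t - 1) = Suc i + t" using that by simp
    ultimately show ?thesis by simp
  qed
  ultimately show ?thesis using that[of g s] z g(2) by simp
qed

subsection \<open>Common continuations of two zero letters\<close>

text \<open>After level \<open>m\<close>, \<open>xs s\<close> continues with the complement up to
  length \<open>U l\<close>, \<open>l = m - (k - 1)\<close>, just as the long block starts. At its
  position \<open>U l\<close> that block reads \<open>of_bool s\<close>, but \<open>xs s\<close> has
  \<open>of_bool (\<not> s)\<close> at \<open>U (m + 1)\<close>.\<close>

lemma agree_long:
  assumes "\<And>t. t < U m \<Longrightarrow> x (q + t) = xs s t"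
    and "\<forall>t<U (m + 2). x (q + U m + t) = xs (\<not> s) t"
  shows "\<And>t. t < U (m + 1) \<Longrightarrow> x (q + t) = xs s t" "x (q + U (m + 1)) \<noteq> xs s (U (m + 1))"
proof -
  let ?l = "m - (k - 1)"
  have l: "U ?l < U (m + 2)" by (rule U_less) simp
  fix t assume t: "t < U (m + 1)"
  show "x (q + t) = xs s t"
  proof (cases "t < U m")
    case False
    then have "t - U m < U ?l" "t = U m + (t - U m)" using t by (simp_all add: U_Suc)
    then show ?thesis using assms(2) l xs_U_add[of "t - U m" m s]
      by (metis add.assoc less_trans)
  qed (rule assms(1))
next
  let ?l = "m - (k - 1)"
  have l: "U ?l < U (m + 2)" by (rule U_less) simp
  then have "x (q + U (m + 1)) = of_bool s"
    using assms(2) xs_U[of "\<not> s" ?l] by (simp add: U_Suc add.assoc)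
  then show "x (q + U (m + 1)) \<noteq> xs s (U (m + 1))" using xs_U[of s "m + 1"] by simp
qed

lemma leave_short:
  assumes "\<forall>t<U m. x (q + U m + t) = xs s t"
  shows "x (q + U m) \<noteq> xs s (U m)"
  using assms U_pos[of m] by (auto simp: xs_U xs_0)

definition exo :: "bool \<Rightarrow> nat \<Rightarrow> nat \<Rightarrow> nat" where
  "exo s m t = (if t < U (m + 1) then xs s t else xs s (t - U (m + 1)))"

text \<open>The two codes are \<open>p\<^sub>m \<not>p\<^sub>m\<^sub>+\<^sub>2\<close> and
  \<open>p\<^sub>m\<^sub>+\<^sub>1 p\<^sub>m\<^sub>+\<^sub>1\<close>. Both start with
  \<open>p\<^sub>m\<^sub>+\<^sub>1 p\<^sub>l\<close>, \<open>l = m - 2(k - 1)\<close> truncated,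
  and then differ.\<close>

lemma common_exceptional:
  assumes long: "\<forall>t<U (m + 2). x (q + U m + t) = xs (\<not> s) t"
    and short: "\<And>t. t < U (m + 1) \<Longrightarrow> x (q' + t) = xs s t"
      "\<forall>t<U (m + 1). x (q' + U (m + 1) + t) = xs s t"
    and eq: "\<And>t. t < n \<Longrightarrow> x (q + t) = x (q' + t)"
  shows "n \<le> U (m + 1) + U (m - 2 * (k - 1))" "\<And>t. t < n \<Longrightarrow> x (q' + t) = exo s m t"
proof -
  let ?l = "m - (k - 1)" and ?l' = "m - 2 * (k - 1)"
  have l': "?l' = ?l - (k - 1)" by simp
  show n: "n \<le> U (m + 1) + U ?l'"
  proof (rule ccontr)
    assume "\<not> ?thesis"
    then have "x (q + (U (m + 1) + U ?l')) = x (q' + (U (m + 1) + U ?l'))" using eq by simp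
    \<comment> \<open>One place, seen as position \<open>U (?l + 1)\<close> of the long block and as
      position \<open>U ?l'\<close> of the second short block; the codes there are opposite.\<close>
    moreover have "U (m + 1) + U ?l' = U m + U (?l + 1)" unfolding l' by (simp add: U_Suc)
    moreover have "x (q + (U m + U (?l + 1))) = of_bool s"
      using long U_less[of "?l + 1" "m + 2"] xs_U[of "\<not> s" "?l + 1"] by (simp add: add.assoc)
    moreover have "x (q' + (U (m + 1) + U ?l')) = of_bool (\<not> s)"
      using short(2) U_less[of ?l' "m + 1"] xs_U[of s ?l'] by (simp add: add.assoc)
    ultimately show False by (cases s) simp_all
  qed
  fix t assume "t < n"
  then have "\<not> t < U (m + 1) \<Longrightarrow> t - U (m + 1) < U (m + 1)"
    using n U_le[of ?l' "m + 1"] U_less[of ?l' "m + 1"] by linarith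
  then show "x (q' + t) = exo s m t" using short
    by (auto simp: exo_def)
qed

definition pre :: "bool \<Rightarrow> nat \<Rightarrow> letter" where
  "pre s m = (nxt ^^ m) (lt (\<not> s) (k - 1))"

text \<open>Each side leaves \<open>xs s\<close> at \<open>U\<close> of its level, or of the next
  level for a long continuation, and both leave at the same place. Distinct predecessors mean
  distinct levels, so one side is long of level \<open>m\<close> and the other short of level
  \<open>m + 1\<close>.\<close>

lemma common_code_after_zero:
  assumes q: "u q = lt s 0" "0 < q" and q': "u q' = lt s 0" "0 < q'"
    and ne: "u (q - 1) \<noteq> u (q' - 1)"
    and eq: "\<And>t. t < n \<Longrightarrow> x (q + t) = x (q' + t)"
    and "t0 < n" "x (q + t0) \<noteq> xs s t0"
  obtains m where "{u (q - 1), u (q' - 1)} = {pre s m, pre s (m + 1)}"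
    "U (m + 1) < n" "n \<le> U (m + 1) + U (m - 2 * (k - 1))"
    "\<And>t. t < n \<Longrightarrow> x (q + t) = exo s m t"
proof -
  from coded_zero_occurrence[OF q] obtain m where m: "u (q - 1) = pre s m"
    "\<And>t. t < U m \<Longrightarrow> x (q + t) = xs s t"
    "(\<forall>t<U m. x (q + U m + t) = xs s t) \<or> (\<forall>t<U (m + 2). x (q + U m + t) = xs (\<not> s) t)"
    (is "?S \<or> ?L") unfolding pre_def by metis
  from coded_zero_occurrence[OF q'] obtain m' where m': "u (q' - 1) = pre s m'"
    "\<And>t. t < U m' \<Longrightarrow> x (q' + t) = xs s t"
    "(\<forall>t<U m'. x (q' + U m' + t) = xs s t) \<or> (\<forall>t<U (m' + 2). x (q' + U m' + t) = xs (\<not> s) t)"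
    (is "?S' \<or> ?L'") unfolding pre_def by metis
  have D: "d = d' \<and> d < n" if "\<And>t. t < d \<Longrightarrow> x (q + t) = xs s t" "x (q + d) \<noteq> xs s d"
    "\<And>t. t < d' \<Longrightarrow> x (q' + t) = xs s t" "x (q' + d') \<noteq> xs s d'" for d d'
  proof -
    have "d < n" using that(1)[of t0] assms(7,8) by (metis le_less_trans not_less)
    then have "d' \<le> d" using that(2) that(3)[of d] eq[of d] by (metis not_less)
    moreover from this \<open>d < n\<close> have "d \<le> d'" using that(4) that(1)[of d'] eq[of d']
      by (metis not_less le_less_trans)
    ultimately show ?thesis using \<open>d < n\<close> by simp
  qed
  have inj: "U a = U b \<longleftrightarrow> a = b" for a b using U_strict_mono by (simp add: strict_mono_eq)
  have "m \<noteq> m'" using m(1) m'(1) ne by auto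
  consider "?L" "?S'" "m' = m + 1" "U (m + 1) < n" | "?S" "?L'" "m = m' + 1" "U (m' + 1) < n"
  proof (cases ?S)
    case S: True
    show ?thesis
    proof (cases ?S')
      case True
      from D[OF m(2) leave_short[OF S] m'(2) leave_short[OF True]] \<open>m \<noteq> m'\<close>
      show ?thesis by (simp add: inj)
    next
      case False
      then have L': ?L' using m'(3) by blast
      from D[OF m(2) leave_short[OF S] agree_long[OF m'(2) L']] that(2)[OF S L']
      show ?thesis by (auto simp: inj)
    qed
  next
    case False
    then have L: ?L using m(3) by blast
    show ?thesis
    proof (cases ?S')
      case True
      from D[OF agree_long[OF m(2) L] m'(2) leave_short[OF True]] that(1)[OF L True]
      show ?thesis by (auto simp: inj)
    next
      case False
      then have L': ?L' using m'(3) by blast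
      from D[OF agree_long[OF m(2) L] agree_long[OF m'(2) L']] \<open>m \<noteq> m'\<close>
      show ?thesis by (simp add: inj)
    qed
  qed
  then show ?thesis
  proof cases
    case 1
    have "\<And>t. t < U (m + 1) \<Longrightarrow> x (q' + t) = xs s t"
      and "\<forall>t<U (m + 1). x (q' + U (m + 1) + t) = xs s t"
      using m'(2) 1(2) unfolding 1(3) by auto
    note c = common_exceptional[OF 1(1) this eq]
    have pre: "{u (q - 1), u (q' - 1)} = {pre s m, pre s (m + 1)}" using m(1) m'(1) 1(3) by simp
    show ?thesis by (rule that[OF pre 1(4) c(1)]) (use eq c(2) in auto)
  next
    case 2
    have "\<And>t. t < U (m' + 1) \<Longrightarrow> x (q + t) = xs s t"
      and "\<forall>t<U (m' + 1). x (q + U (m' + 1) + t) = xs s t"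
      using m(2) 2(1) unfolding 2(3) by auto
    note c = common_exceptional[OF 2(2) this eq[symmetric]]
    have pre: "{u (q - 1), u (q' - 1)} = {pre s m', pre s (m' + 1)}"
      using m(1) m'(1) 2(3) by auto
    show ?thesis by (rule that[OF pre 2(4) c(1)]) (use c(2) in auto)
  qed
qed

subsection \<open>Factors\<close>

definition occurs :: "letter list \<Rightarrow> bool" where
  "occurs w \<longleftrightarrow> (\<exists>q. occ_at q w)"

lemma occurs_sublist: "occurs (v @ w @ z) \<Longrightarrow> occurs w"
  by (auto simp: occurs_def occ_at_append)

lemma occurs_morphism: "occurs w \<Longrightarrow> occurs (mor w)"
  using occ_at_morphism by (auto simp: occurs_def)

lemma occurs_nxt_blk:
  assumes "occurs (a # blk s m)"
  shows "occurs (nxt a # blk s (Suc m))"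
proof -
  have "mor (a # blk s m) = butlast (xi k a) @ (nxt a # blk s (Suc m)) @ []"
    by (simp add: mor_blk[symmetric] nxt_def morphism_def append_butlast_last_id[symmetric]
        del: append_butlast_last_id)
  then show ?thesis using occurs_morphism[OF assms] occurs_sublist by metis
qed

lemma occurs_nxt_pow_blk: "occurs (a # blk s m) \<Longrightarrow> occurs ((nxt ^^ n) a # blk s (n + m))"
  by (induction n) (simp_all add: occurs_nxt_blk)

lemma nxt_pow: "j < k \<Longrightarrow> (nxt ^^ j) (lt s 0) = lt s j"
  by (induction j) (simp_all add: nxt_lt)

lemma nxt_pow_k: "(nxt ^^ k) (lt s 0) = lt (\<not> s) 0"
proof -
  have "(nxt ^^ Suc (k - 1)) (lt s 0) = lt (\<not> s) 0"
    using k4 by (simp only: funpow.simps o_apply nxt_pow diff_less) (simp add: nxt_pow nxt_lt)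
  then show ?thesis using k4 by simp
qed

lemma blk_prefix: "\<exists>z. blk s (m + d) = blk s m @ z"
  by (induction d) (auto simp: blk_Suc)

lemma occurs_blk: "occurs (blk s m)"
proof -
  have False: "occurs (blk False n)" for n
    unfolding occurs_def
    by (rule exI[of _ 0]) (use u_word_prefix[of _ n k] in \<open>auto simp: occ_at_def blk_def lt_def\<close>)
  have "blk False (Suc (k - 1)) = blk False (k - 1) @ [lt True 0] @ []"
    using iterate_one_wrap[of "k - 1" False] by (simp add: blk_Suc blk_0)
  then have "occurs (blk True 0)"
    using False[of "Suc (k - 1)"] occurs_sublist by (metis blk_0)
  then have "occurs (blk True n)" for n
    by (induction n) (simp_all add: occurs_morphism mor_blk[symmetric])
  with False show ?thesis by (cases s) auto
qed

lemma occurs_top_zero: "occurs [lt (\<not> s) (k - 1), lt s 0]"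
proof -
  let ?r = "\<not> s"
  have e: "Suc (k - 2) = k - 1" using k4 by simp
  have "(mor ^^ (k - 2)) [lt ?r 1] = [lt ?r (k - 1)]"
    using iterate_one[of "k - 2" ?r] k4 e by simp
  moreover have "(mor ^^ Suc (k - 2)) [lt ?r 1] = [lt s 0]"
    using iterate_one_wrap[of "k - 1" ?r] unfolding e by (simp add: blk_0)
  ultimately have "blk ?r (Suc (Suc (k - 2))) = blk ?r (k - 2) @ [lt ?r (k - 1), lt s 0] @ []"
    unfolding blk_Suc by simp
  then show ?thesis using occurs_blk occurs_sublist by metis
qed

lemma nxt_pow_onto:
  assumes "j < k"
  shows "\<exists>p\<ge>n. (nxt ^^ p) (lt s 0) = lt r j"
proof (induction n)
  case 0
  show ?case
  proof (cases "r = s")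
    case True
    then show ?thesis using nxt_pow[OF assms] by blast
  next
    case False
    have "(nxt ^^ (j + k)) (lt s 0) = lt r j"
      unfolding funpow_add o_apply nxt_pow_k using False nxt_pow[OF assms] by simp
    then show ?thesis by blast
  qed
next
  case (Suc n)
  then obtain p where p: "n \<le> p" "(nxt ^^ p) (lt s 0) = lt r j" by blast
  then have "(nxt ^^ (p + (k + k))) (lt s 0) = lt r j"
    unfolding funpow_add o_apply nxt_pow_k by simp
  then show ?case using p(1) k4 by (intro exI[of _ "p + (k + k)"]) simp
qed

text \<open>Apply powers of the morphism to \<open>lt s 0\<close> before \<open>blk s 1\<close>. The
  first letter runs around the whole cycle, so some power \<open>p \<ge> m\<close> produces the
  wanted letter, and the block has by then outgrown level \<open>m\<close>.\<close>

lemma occurs_letter_blk: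
  assumes "j < k"
  shows "occurs (lt r j # blk s m)"
proof -
  have "nxt (lt (\<not> s) (k - 1)) = lt s 0" using k4 by (simp add: nxt_lt)
  then have start: "occurs (lt s 0 # blk s 1)"
    using occurs_nxt_blk[of "lt (\<not> s) (k - 1)" s 0] occurs_top_zero[of s] by (simp add: blk_0)
  obtain p where p: "m \<le> p" "(nxt ^^ p) (lt s 0) = lt r j" using nxt_pow_onto[OF assms] by blast
  from blk_prefix[of s m "p + 1 - m"] p(1) obtain z where "blk s (p + 1) = blk s m @ z" by auto
  then have "occurs ([] @ (lt r j # blk s m) @ z)"
    using occurs_nxt_pow_blk[OF start, of p] p(2) by simp
  then show ?thesis by (rule occurs_sublist)
qed

lemma xs_occurs:
  assumes "j < k"
  obtains q where "u q = lt r j" "u (Suc q) = lt s 0" "\<And>t. t < n \<Longrightarrow> x (Suc q + t) = xs s t"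
proof -
  obtain q where "occ_at q (lt r j # blk s n)"
    using occurs_letter_blk[OF assms, unfolded occurs_def] by blast
  then have q: "u q = lt r j" "occ_at (Suc q) (blk s n)" by (simp_all add: occ_at_Cons)
  have "x (Suc q + t) = xs s t" if "t < n" for t
    using that U_ge[of n] by (intro occ_at_blk_x[OF q(2)]) simp
  moreover have "u (Suc q) = lt s 0"
    using q(2) blk_prefix[of s 0 n] by (auto simp: blk_0 occ_at_Cons)
  ultimately show ?thesis using that q(1) by blast
qed

lemma in_factors: "y \<in> factors f n \<longleftrightarrow> length y = n \<and> (\<exists>i. \<forall>t<n. y ! t = f (i + t))"
proof
  assume "y \<in> factors f n"
  then show "length y = n \<and> (\<exists>i. \<forall>t<n. y ! t = f (i + t))" by (auto simp: factors_def)
next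
  assume r: "length y = n \<and> (\<exists>i. \<forall>t<n. y ! t = f (i + t))"
  then obtain i where "\<forall>t<n. y ! t = f (i + t)" by blast
  with r have "y = map f [i..<i + n]" by (intro nth_equalityI) auto
  then show "y \<in> factors f n" by (auto simp: factors_def)
qed

lemma finite_factors: "finite (factors x n)"
proof (rule finite_subset)
  show "factors x n \<subseteq> {y. set y \<subseteq> {..1} \<and> length y = n}"
    using x_le_1 by (auto simp: factors_def)
qed (simp add: finite_lists_length_eq)

subsection \<open>Left special factors and complexity\<close>

definition LS :: "nat \<Rightarrow> nat list set" where
  "LS n = {y. 0 # y \<in> factors x (n + 1) \<and> 1 # y \<in> factors x (n + 1)}"

lemma factors_tl: "d # y \<in> factors f (n + 1) \<Longrightarrow> y \<in> factors f n"
  by (auto simp: in_factors) (metis Suc_less_eq add_Suc_right add_Suc nth_Cons_Suc)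

lemma left_extension:
  assumes "y \<in> factors x n"
  shows "0 # y \<in> factors x (n + 1) \<or> 1 # y \<in> factors x (n + 1)"
proof -
  obtain i where i: "length y = n" "\<forall>t<n. y ! t = x (i + t)" using assms by (auto simp: in_factors)
  \<comment> \<open>An occurrence at position 0 has no predecessor, so a later copy of the prefix of
    length \<open>n + i\<close> is used.\<close>
  obtain q where "\<And>t. t < n + i \<Longrightarrow> x (Suc q + t) = xs False t"
    using xs_occurs[of 0 False False "n + i"] k4 by auto
  then have "\<forall>t<n. y ! t = x (Suc (q + i) + t)" using i by (simp add: xs_def add.assoc)
  then have "\<forall>t<n + 1. (x (q + i) # y) ! t = x (q + i + t)"
    by (auto simp: nth_Cons split: nat.splits)
  then have "x (q + i) # y \<in> factors x (n + 1)" using i(1) by (auto simp: in_factors)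
  then show ?thesis using x_le_1[of "q + i"] by (cases "x (q + i)") auto
qed

lemma complexity_Suc:
  "factor_complexity x (n + 1) = factor_complexity x n + card (LS n)"
proof -
  define A where "A d = {y. d # y \<in> factors x (n + 1)}" for d :: nat
  have un: "A 0 \<union> A 1 = factors x n"
  proof (intro equalityI subsetI)
    fix y assume "y \<in> A 0 \<union> A 1"
    then show "y \<in> factors x n" unfolding A_def using factors_tl[of _ _ x n] by blast
  next
    fix y assume "y \<in> factors x n"
    then show "y \<in> A 0 \<union> A 1" unfolding A_def using left_extension[of y n] by blast
  qed
  then have fin: "finite (A 0)" "finite (A 1)" using finite_factors by (metis finite_Un)+
  have "factors x (n + 1) = Cons 0 ` A 0 \<union> Cons 1 ` A 1"
  proof (intro equalityI subsetI)
    fix w assume w: "w \<in> factors x (n + 1)"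
    then obtain i where "length w = n + 1" "w ! 0 = x i" by (auto simp: in_factors)
    then obtain y where "w = x i # y" by (cases w) auto
    then show "w \<in> Cons 0 ` A 0 \<union> Cons 1 ` A 1"
      using w x_le_1[of i] by (cases "x i") (auto simp: A_def)
  qed (auto simp: A_def)
  then have "card (factors x (n + 1)) = card (A 0) + card (A 1)"
    using fin by (subst \<open>factors x (n + 1) = _\<close>, subst card_Un_disjoint)
      (auto simp: card_image)
  also have "\<dots> = card (A 0 \<union> A 1) + card (A 0 \<inter> A 1)" by (rule card_Un_Int[OF fin])
  also have "A 0 \<inter> A 1 = LS n" by (auto simp: A_def LS_def)
  finally show ?thesis unfolding un factor_complexity_def .
qed

lemma factors_bar:
  assumes "y \<in> factors x n"
  shows "map (\<lambda>b. 1 - b) y \<in> factors x n"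
proof -
  obtain i where i: "length y = n" "\<forall>t<n. y ! t = x (i + t)" using assms by (auto simp: in_factors)
  obtain q where "\<And>t. t < n + i \<Longrightarrow> x (Suc q + t) = xs True t"
    using xs_occurs[of 0 False True "n + i"] k4 by auto
  then have "\<forall>t<n. map (\<lambda>b. 1 - b) y ! t = x (Suc (q + i) + t)"
    using i by (simp add: xs_def add.assoc)
  then show ?thesis
    unfolding in_factors using i(1) by (intro conjI exI[of _ "Suc (q + i)"]) simp_all
qed

lemma LS_bar: "y \<in> LS n \<Longrightarrow> map (\<lambda>b. 1 - b) y \<in> LS n"
  using factors_bar[of "0 # y" "n + 1"] factors_bar[of "1 # y" "n + 1"] by (simp add: LS_def)

lemma LS_le_1: "y \<in> LS n \<Longrightarrow> length y = n \<and> (\<forall>t<n. y ! t \<le> 1)"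
  using factors_tl[of 0 y x n] x_le_1 by (auto simp: LS_def in_factors)

section \<open>The regular left special factors\<close>

definition graft :: "nat \<Rightarrow> nat \<Rightarrow> nat \<Rightarrow> (nat \<Rightarrow> nat) \<Rightarrow> nat list" where
  "graft n i d f = map (\<lambda>t. if t < i then d else f (t - i)) [0..<n]"

lemma length_graft [simp]: "length (graft n i d f) = n"
  by (simp add: graft_def)

lemma nth_graft: "t < n \<Longrightarrow> graft n i d f ! t = (if t < i then d else f (t - i))"
  by (simp add: graft_def)

text \<open>All empty runs coincide, so length 0 is indexed once; there are \<open>2 * k - 1\<close>
  runs, each followed by \<open>x\<close> or its complement.\<close>

definition Main_LS :: "nat \<Rightarrow> nat list set" where
  "Main_LS n = (\<lambda>((i, d), s). graft n i d (xs s)) ` ((insert (0, 0) ({1..<k} \<times> {0, 1})) \<times> UNIV)"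

lemma in_Main_LS:
  "y \<in> Main_LS n \<longleftrightarrow> (\<exists>i d s. i < k \<and> d \<le> 1 \<and> y = graft n i d (xs s))"
proof
  assume "\<exists>i d s. i < k \<and> d \<le> 1 \<and> y = graft n i d (xs s)"
  then obtain i d s where y: "i < k" "d \<le> 1" "y = graft n i d (xs s)" by blast
  show "y \<in> Main_LS n"
  proof (cases "i = 0")
    case True
    then have "y = graft n 0 0 (xs s)" using y by (simp add: graft_def)
    then show ?thesis by (force simp: Main_LS_def)
  next
    case False
    then show ?thesis using y by (force simp: Main_LS_def le_Suc_eq)
  qed
next
  assume "y \<in> Main_LS n"
  then obtain p where p: "p \<in> insert (0, 0) ({1..<k} \<times> {0, 1}) \<times> UNIV"
    "y = (\<lambda>((i, d), s). graft n i d (xs s)) p" unfolding Main_LS_def by blast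
  moreover obtain i d s where "p = ((i, d), s)" by (metis surj_pair)
  ultimately have "(i, d) \<in> insert (0, 0) ({1..<k} \<times> {0, 1})" "y = graft n i d (xs s)" by auto
  moreover from this have "i < k" "d \<le> 1" using k4 by auto
  ultimately show "\<exists>i d s. i < k \<and> d \<le> 1 \<and> y = graft n i d (xs s)" by blast
qed

lemma xs_small: "xs s 0 \<noteq> xs s 1" "xs s 1 = xs s 2"
  using xs_U[of s 0] xs_U[of s 1] by (simp_all add: U_0 U_Suc xs_0 numeral_2_eq_2)

text \<open>\<open>xs s\<close> begins with a pattern abb, a and b distinct. In the other word it
  would start inside the run, so either its first two letters are equal or its last two are the
  distinct first letters of \<open>xs s'\<close>.\<close>

lemma graft_inject_less:
  assumes "graft n i d (xs s) = graft n i' d' (xs s')" "i + 2 < n"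
  shows "\<not> i < i'"
proof
  assume "i < i'"
  have nth: "(if t < i then d else xs s (t - i)) = (if t < i' then d' else xs s' (t - i'))"
    if "t < n" for t using assms(1) that by (metis nth_graft)
  from nth[of i] nth[of "i + 1"] nth[of "i + 2"] \<open>i < i'\<close> assms(2) xs_small[of s] xs_small[of s']
  show False by (cases "i' = i + 1"; cases "i' = i + 2") (auto split: if_splits simp: numeral_2_eq_2)
qed

lemma card_Main_LS:
  assumes "k + 2 < n"
  shows "card (Main_LS n) = 4 * k - 2"
proof -
  let ?I = "(insert (0, 0) ({1..<k} \<times> {0, 1 :: nat})) \<times> (UNIV :: bool set)"
  have "inj_on (\<lambda>((i, d), s). graft n i d (xs s)) ?I"
  proof (rule inj_onI, clarify)
    fix i d s i' d' s'
    assume I: "(i, d) \<in> insert (0, 0) ({1..<k} \<times> {0, 1})"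
      "(i', d') \<in> insert (0, 0) ({1..<k} \<times> {0, 1})"
      and eq: "graft n i d (xs s) = graft n i' d' (xs s')"
    have "i < k" "i' < k" using I k4 by auto
    then have "i = i'" using graft_inject_less[OF eq] graft_inject_less[OF eq[symmetric]] assms by simp
    moreover have "s = s'" using arg_cong[OF eq, of "\<lambda>w. w ! i"] \<open>i = i'\<close> \<open>i < k\<close> assms
      by (cases s; cases s') (simp_all add: nth_graft xs_0)
    moreover have "d = d'" using arg_cong[OF eq, of "\<lambda>w. w ! 0"] \<open>i = i'\<close> I assms
      by (cases "i = 0") (auto simp: nth_graft)
    ultimately show "(i, d) = (i', d') \<and> s = s'" by simp
  qed
  then have "card (Main_LS n) = card ?I" by (simp add: Main_LS_def card_image)
  also have "\<dots> = (1 + (k - 1) * 2) * 2" by (simp add: card_cartesian_product)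
  finally show ?thesis using k4 by (simp add: algebra_simps diff_mult_distrib2)
qed

lemma Main_LS_bar: "y \<in> Main_LS n \<Longrightarrow> map (\<lambda>b. 1 - b) y \<in> Main_LS n"
proof -
  assume "y \<in> Main_LS n"
  then obtain i d s where y: "i < k" "d \<le> 1" "y = graft n i d (xs s)" by (auto simp: in_Main_LS)
  then have "map (\<lambda>b. 1 - b) y = graft n i (1 - d) (xs (\<not> s))"
    by (intro nth_equalityI) (auto simp: nth_graft xs_not)
  then show ?thesis using y(1) by (metis in_Main_LS diff_le_self)
qed

text \<open>A letter of code \<open>d\<close> and height \<open>h\<close> before \<open>xs s\<close>
  ends a past with code \<open>1 - d\<close> and then \<open>h\<close> copies of \<open>d\<close>;
  both factors are cut out of this.\<close>

lemma extend_graft: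
  assumes "d \<le> 1" "1 \<le> h" "h \<le> k"
  shows "d # graft n (h - 1) d (xs s) \<in> factors x (n + 1)"
    and "(1 - d) # graft n h d (xs s) \<in> factors x (n + 1)"
proof -
  define j where "j = (if h < k then h else 0)"
  define r where "r = (if h < k then d = 0 else d = 1)"
  have "j < k" "coding (lt r j) = d" "ht (lt r j) = h"
    using assms k4 by (auto simp: j_def r_def le_Suc_eq)
  then obtain q where q: "coding (u q) = d" "ht (u q) = h" "u (Suc q) = lt s 0"
    "\<And>t. t < n \<Longrightarrow> x (Suc q + t) = xs s t"
    using xs_occurs[of j r s n] by metis
  note past = code_before_zero[OF q(3), unfolded q(1,2)]
  have run: "x (q - h + t) = d" if "0 < t" "t \<le> h" for t
    using past(1) past(2)[of "h - t"] that by simp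
  have tail: "x (q - h + t) = xs s (t - Suc h)" if "h < t" "t \<le> n + h" for t
  proof -
    have "q - h + t = Suc q + (t - Suc h)" using past(1) that by simp
    then show ?thesis using q(4)[of "t - Suc h"] that by simp
  qed
  have "(d # graft n (h - 1) d (xs s)) ! t = x (q - h + 1 + t)" if "t < n + 1" for t
    using run[of "t + 1"] tail[of "t + 1"] assms(2) that by (cases t) (auto simp: nth_graft)
  then show "d # graft n (h - 1) d (xs s) \<in> factors x (n + 1)"
    unfolding in_factors by (intro conjI exI[of _ "q - h + 1"]) simp_all
  have "((1 - d) # graft n h d (xs s)) ! t = x (q - h + t)" if "t < n + 1" for t
    using run[of t] tail[of t] past(3) assms(2) that by (cases t) (auto simp: nth_graft)
  then show "(1 - d) # graft n h d (xs s) \<in> factors x (n + 1)"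
    unfolding in_factors by (intro conjI exI[of _ "q - h"]) simp_all
qed

text \<open>A nonempty run of length \<open>i\<close> extends by its own letter \<open>d\<close>
  using height \<open>i + 1\<close>, and by \<open>1 - d\<close> using height
  \<open>i\<close>.\<close>

lemma Main_LS_subset: "Main_LS n \<subseteq> LS n"
proof
  fix y assume "y \<in> Main_LS n"
  then obtain i d s where y: "i < k" "d \<le> 1" "y = graft n i d (xs s)" by (auto simp: in_Main_LS)
  have d: "e # y \<in> factors x (n + 1)" if "e \<le> 1" for e
  proof (cases "i = 0 \<or> e = d")
    case True
    then have "y = graft n i e (xs s)" using y(3) by (auto simp: graft_def)
    then show ?thesis using extend_graft(1)[of e "i + 1" n s] that y(1) by simp
  next
    case False
    then have "e = 1 - d" using that y(2) by auto
    then show ?thesis using extend_graft(2)[of d i n s] y False by simp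
  qed
  show "y \<in> LS n" using d[of 0] d[of 1] by (simp add: LS_def)
qed

section \<open>Exceptional left special factors and the count\<close>

definition exc :: "nat \<Rightarrow> bool \<Rightarrow> nat \<Rightarrow> nat list" where
  "exc n s m = graft n (merge (pre s m) (pre s (m + 1))) (coding (pre s m)) (exo s m)"

text \<open>Desubstituting the two left extensions leads past a run of length \<open>g\<close> to
  zeros with different predecessors. Their common continuation either follows \<open>xs s\<close>
  throughout, or leaves it and fixes the level \<open>m\<close>.\<close>

lemma LS_cases:
  assumes "y \<in> LS n" "k + 7 \<le> n"
  obtains "y \<in> Main_LS n"
  | s m g where "y = exc n s m" "g < k" "U (m + 1) < n - g"
      "n - g \<le> U (m + 1) + U (m - 2 * (k - 1))"
proof -
  obtain i where i: "length y = n" "\<forall>t<n + 1. (0 # y) ! t = x (i + t)"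
    using assms(1) by (auto simp: LS_def in_factors)
  obtain j where j: "\<forall>t<n + 1. (1 # y) ! t = x (j + t)"
    using assms(1) by (auto simp: LS_def in_factors)
  have yi: "y ! t = x (Suc i + t)" and yj: "y ! t = x (Suc j + t)" if "t < n" for t
    using i(2)[rule_format, of "Suc t"] j[rule_format, of "Suc t"] that by simp_all
  have "x i \<noteq> x j" using i(2)[rule_format, of 0] j[rule_format, of 0] by simp
  then obtain s g where g: "u (i + g + 1) = lt s 0" "u (j + g + 1) = lt s 0"
    "u (i + g) \<noteq> u (j + g)" "g = merge (u (i + g)) (u (j + g))"
    "\<And>t. t < g \<Longrightarrow> x (Suc i + t) = coding (u (i + g))"
    using left_special_desubstitute[of i j n] yi yj assms(2) by metis
  have "g < k" using merge_less[OF g(3)] g(4) by simp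
  let ?q = "i + g + 1" and ?q' = "j + g + 1"
  have y: "y ! t = (if t < g then coding (u (i + g)) else x (?q + (t - g)))" if "t < n" for t
    using yi[OF that] g(5)[of t] by simp
  show ?thesis
  proof (cases "\<forall>t<n - g. x (?q + t) = xs s t")
    case True
    then have "y ! t = (if t < g then coding (u (i + g)) else xs s (t - g))" if "t < n" for t
      unfolding y[OF that] using that True[rule_format, of "t - g"] by (cases "t < g") simp_all
    then have "y = graft n g (coding (u (i + g))) (xs s)"
      using i(1) by (intro nth_equalityI) (simp_all add: nth_graft)
    then show ?thesis using that(1) \<open>g < k\<close> coding_le_1 by (auto simp: in_Main_LS)
  next
    case False
    then obtain t0 where t0: "t0 < n - g" "x (?q + t0) \<noteq> xs s t0" by blast
    have eq: "x (?q + t) = x (?q' + t)" if "t < n - g" for t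
      using yi[of "g + t"] yj[of "g + t"] that by (simp add: add_ac)
    have ne: "u (?q - 1) \<noteq> u (?q' - 1)" using g(3) by simp
    obtain m where m: "{u (?q - 1), u (?q' - 1)} = {pre s m, pre s (m + 1)}" "U (m + 1) < n - g"
      "n - g \<le> U (m + 1) + U (m - 2 * (k - 1))" "\<And>t. t < n - g \<Longrightarrow> x (?q + t) = exo s m t"
      using common_code_after_zero[OF g(1) _ g(2) _ ne eq t0] by (metis add_gr_0 zero_less_one)
    have "g = merge (pre s m) (pre s (m + 1))"
      using g(4) m(1) merge_commute by (auto simp: doubleton_eq_iff)
    moreover have "y ! t = (if t < g then coding (u (i + g)) else exo s m (t - g))" if "t < n" for t
      unfolding y[OF that] using that m(4)[of "t - g"] by (cases "t < g") simp_all
    moreover have "0 < g \<Longrightarrow> coding (u (i + g)) = coding (pre s m)"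
      using g(4) m(1) by (auto simp: doubleton_eq_iff merge_def split: if_splits)
    ultimately have "y = exc n s m"
      using i(1) by (intro nth_equalityI) (auto simp: nth_graft exc_def)
    then show ?thesis using that(2) \<open>g < k\<close> m(2,3) by blast
  qed
qed

lemma U_gap: "U m + d \<le> U (m + d)"
  by (induction d) (use U_less in \<open>auto intro: Suc_leI le_less_trans\<close>)

text \<open>The lengths at which exceptional left special factors exist lie in disjoint intervals
  for different levels, even after a shift by less than \<open>k\<close>.\<close>

lemma exceptional_level_unique:
  assumes "k + 2 * U (2 * k) \<le> n"
    and "g < k" "n - g \<le> U (m + 1) + U (m - 2 * (k - 1))"
    and "U (m' + 1) < n - g'"
  shows "m' \<le> m"
proof (rule ccontr)
  assume "\<not> ?thesis"
  then have "U (m + 2) \<le> U (m' + 1)" by (intro U_le) simp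
  then have n: "U (m + 1) + U (m + 1 - (k - 1)) < n" using assms(4) U_Suc[of "m + 1"] by simp
  show False
  proof (cases "2 * (k - 1) \<le> m")
    case True
    \<comment> \<open>Raising the level by \<open>k\<close> gains at least \<open>k\<close>, which
      absorbs the shift \<open>g < k\<close>.\<close>
    then have "m + 1 - (k - 1) = m - 2 * (k - 1) + k" using k4 by simp
    then have "U (m - 2 * (k - 1)) + k \<le> U (m + 1 - (k - 1))" by (simp only: U_gap)
    then show False using assms(2,3) n by linarith
  next
    case False
    then have "U (m + 1) \<le> U (2 * k)" "U (m - 2 * (k - 1)) \<le> U (2 * k)" by (auto intro: U_le)
    then show False using assms(1-3) by simp
  qed
qed

text \<open>Exceptional words share one level, so there are at most two; complementation acts on
  them without a fixed word, so there are none or two. The bound on \<open>n\<close> covers both the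
  marker window and the separation of levels.\<close>

lemma card_LS:
  assumes n: "k + 7 + 2 * U (2 * k) \<le> n"
  shows "card (LS n) \<in> {4 * k - 2, 4 * k}"
proof -
  let ?E = "LS n - Main_LS n" and ?bar = "map (\<lambda>b. 1 - b) :: nat list \<Rightarrow> nat list"
  have fin: "finite (LS n)"
  proof (rule finite_subset)
    show "LS n \<subseteq> factors x n" unfolding LS_def using factors_tl[of _ _ x n] by blast
  qed (rule finite_factors)
  have "card (LS n) = card (Main_LS n) + card ?E"
    using Main_LS_subset[of n] fin by (metis Diff_partition card_Un_disjoint Diff_disjoint finite_Diff finite_subset)
  moreover have "card (Main_LS n) = 4 * k - 2" using n by (intro card_Main_LS) simp
  moreover have "card ?E = 0 \<or> card ?E = 2"
  proof (cases "?E = {}")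
    case False
    then obtain y where y: "y \<in> LS n" "y \<notin> Main_LS n" by blast
    have "k + 7 \<le> n" and n': "k + 2 * U (2 * k) \<le> n" using n by simp_all
    obtain m g where m: "g < k" "U (m + 1) < n - g" "n - g \<le> U (m + 1) + U (m - 2 * (k - 1))"
      using LS_cases[OF y(1) \<open>k + 7 \<le> n\<close>] y(2) by metis
    have "?E \<subseteq> {exc n False m, exc n True m}"
    proof
      fix z assume z: "z \<in> ?E"
      then obtain s' m' g' where z': "z = exc n s' m'" "g' < k" "U (m' + 1) < n - g'"
        "n - g' \<le> U (m' + 1) + U (m' - 2 * (k - 1))"
        using LS_cases[of z n] \<open>k + 7 \<le> n\<close> by blast
      have "m' = m"
        using exceptional_level_unique[OF n' m(1,3) z'(3)] exceptional_level_unique[OF n' z'(2,4) m(2)]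
        by simp
      then show "z \<in> {exc n False m, exc n True m}" using z'(1) by (cases s') auto
    qed
    then have "card ?E \<le> card {exc n False m, exc n True m}" by (intro card_mono) simp_all
    also have "\<dots> \<le> 2" by (simp add: card_insert_if)
    finally have "card ?E \<le> 2" .
    have bits: "length y = n" "\<forall>t<n. y ! t \<le> 1" using LS_le_1[OF y(1)] by auto
    have "?bar (?bar y) = y"
      using bits by (intro nth_equalityI) auto
    then have "?bar y \<in> ?E" using y LS_bar Main_LS_bar by (metis DiffI)
    moreover have "?bar y \<noteq> y"
    proof
      assume "?bar y = y"
      then have "1 - y ! 0 = y ! 0" using bits(1) n k4 by (metis nth_map add_leD1 le_zero_eq not_numeral_le_zero gr_zeroI)
      then show False by arith
    qed
    ultimately have "card {y, ?bar y} \<le> card ?E"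
      using y fin by (intro card_mono) auto
    then have "2 \<le> card ?E" using \<open>?bar y \<noteq> y\<close> by simp
    then show ?thesis using \<open>card ?E \<le> 2\<close> by simp
  next
    case True
    then show ?thesis by (simp only: card.empty simp_thms)
  qed
  ultimately show ?thesis using k4 by auto
qed

end

theorem theorem3:
  fixes k :: nat
  assumes "k \<ge> 4"
  shows "\<exists>N0. \<forall>N\<ge>N0.
    int (factor_complexity (x_word k) (N + 1)) - int (factor_complexity (x_word k) N)
      \<in> {4 * int k - 2, 4 * int k}"
proof -
  interpret xi_word k by unfold_locales (rule assms)
  have "int (factor_complexity x (N + 1)) - int (factor_complexity x N) \<in> {4 * int k - 2, 4 * int k}"
    if "N \<ge> k + 7 + 2 * U (2 * k)" for N
    using card_LS[OF that] complexity_Suc[of N] assms by auto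
  then show ?thesis by blast
qed

end
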